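(* Let $(\alpha,\beta)$ belong to $\mathcal{D} = \{(\alpha,\beta) : \alpha/2 \leqslant \beta \leqslant \alpha^2,\ 1/2 \leqslant \alpha \leqslant 1\} \setminus \{(1,1)\}$. Then every $(\alpha,\beta)$-grandchildren-balanced tree with $\mathbf{N}$ nodes has height $h \leqslant -2 \log_\beta(\mathbf{N}+1)$.
   Context: Binary trees are considered. The weight $|\mathcal{T}|$ of a binary tree $\mathcal{T}$ is its number of empty sub-trees (equivalently, its number of nodes plus one); the weight $|n|$ of a node $n$ is the weight of the sub-tree rooted at $n$. By convention, each empty tree (weight $1$) is viewed as an infinite complete binary tree whose nodes at depth $d$ have weight $2^{-d}$, so that every node formally has two children and four grandchildren. For a node $n$ with children $n_1,n_2$ and grandchildren $n_{11},n_{12},n_{21},n_{22}$, define $\mathsf{bal_C}(n)=\max\{|n_1|,|n_2|\}/|n|$ and $\mathsf{bal_{GC}}(n)=\max\{|n_{11}|,|n_{12}|,|n_{21}|,|n_{22}|\}/|n|$. The node $n$ is $(\alpha,\beta)$-balanced if $\mathsf{bal_C}(n)\leqslant\alpha$ and $\mathsf{bal_{GC}}(n)\leqslant\beta$. A tree is $(\alpha,\beta)$-grandchildren-balanced (a $\mathrm{GCB}_{\alpha,\beta}$-tree) if all its nodes are $(\alpha,\beta)$-balanced. The height of a tree is the maximal depth of its nodes, the root having depth $0$. *)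

theory Defs
  imports Complex_Main "HOL-Library.Tree"
begin

text \<open>
  The weight of the node reached from the root by a path (\<^const>\<open>False\<close> = left child,
  \<^const>\<open>True\<close> = right child). A path may run past an empty tree, which is viewed as
  an infinite complete tree whose weights halve at each level.
  The weight \<^const>\<open>size1\<close> of a tree is its number of empty sub-trees.
\<close>

fun weight_at :: "'a tree \<Rightarrow> bool list \<Rightarrow> real" where
  "weight_at t [] = real (size1 t)"
| "weight_at Leaf (b # p) = weight_at (Leaf :: 'a tree) p / 2"
| "weight_at (Node l x r) (b # p) = weight_at (if b then r else l) p"

lemma weight_at_Leaf: "weight_at Leaf p = (1 / 2) ^ length p"
proof (induction p)
  case (Cons b p)
  then show ?case by simp
qed simp

text \<open>A node is identified with the sub-tree rooted at it.\<close>

definition bal_C :: "'a tree \<Rightarrow> real" where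
  "bal_C t = Max {weight_at t [a] | a. True} / real (size1 t)"

definition bal_GC :: "'a tree \<Rightarrow> real" where
  "bal_GC t = Max {weight_at t [a, b] | a b. True} / real (size1 t)"

definition balanced_node :: "real \<Rightarrow> real \<Rightarrow> 'a tree \<Rightarrow> bool" where
  "balanced_node \<alpha> \<beta> t \<longleftrightarrow> bal_C t \<le> \<alpha> \<and> bal_GC t \<le> \<beta>"

definition GCB :: "real \<Rightarrow> real \<Rightarrow> 'a tree \<Rightarrow> bool" where
  "GCB \<alpha> \<beta> t \<longleftrightarrow> (\<forall>n \<in> subtrees t. n \<noteq> Leaf \<longrightarrow> balanced_node \<alpha> \<beta> n)"

fun node_depths :: "'a tree \<Rightarrow> nat set" where
  "node_depths Leaf = {}"
| "node_depths (Node l x r) = insert 0 (Suc ` (node_depths l \<union> node_depths r))"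

text \<open>
  The maximal depth of a node, the root having depth 0. This is one less than the library's
  \<^const>\<open>height\<close> for a nonempty tree; the empty tree, which has no node, gets the value 0.
\<close>

definition max_depth :: "'a tree \<Rightarrow> nat" where
  "max_depth t = (if t = Leaf then 0 else Max (node_depths t))"

lemma finite_node_depths [simp]: "finite (node_depths t)"
  by (induction t) auto

lemma node_depths_eq: "node_depths t = {..<height t}"
proof (induction t)
  case (Node l x r)
  have "{..<height l} \<union> {..<height r} = {..<max (height l) (height r)}"
    by auto
  with Node show ?case
    by (simp add: lessThan_Suc_eq_insert_0)
qed simp

lemma max_depth_eq_height: "max_depth t = height t - 1"
proof (cases t)
  case (Node l x r)
  then have "node_depths t = {..max (height l) (height r)}"
    by (simp only: node_depths_eq) (auto simp: less_Suc_eq_le)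
  with Node show ?thesis
    by (simp add: max_depth_def del: node_depths.simps) (auto intro: Max_eqI)
qed (simp add: max_depth_def)

definition GCB_domain :: "(real \<times> real) set" where
  "GCB_domain = {(\<alpha>, \<beta>). \<alpha> / 2 \<le> \<beta> \<and> \<beta> \<le> \<alpha>\<^sup>2 \<and> 1 / 2 \<le> \<alpha> \<and> \<alpha> \<le> 1} - {(1, 1)}"

end

(* Descending two levels multiplies the weight by at most \<beta>, so the quantity weight\<^sup>2 * \<beta>^depth does not
   increase when a tree is replaced by its tallest grandchild. It is at least 1 for trees of depth at most 1,
   because \<beta> \<ge> 1/4; hence it is always at least 1, which is the claim up to taking logarithms. *)
theory Submission
  imports Defs
begin

lemma subtrees_trans:
  "u \<in> subtrees t \<Longrightarrow> subtrees u \<subseteq> subtrees t"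
  by (induction t) auto

lemma GCB_subtree:
  assumes "GCB \<alpha> \<beta> t" "u \<in> subtrees t"
  shows "GCB \<alpha> \<beta> u"
  using assms subtrees_trans unfolding GCB_def by blast

lemma weight_grandchild_le:
  assumes "GCB \<alpha> \<beta> t" "t \<noteq> Leaf"
  shows "weight_at t [a, b] \<le> \<beta> * real (size1 t)"
proof -
  have "t \<in> subtrees t"
    by (cases t) auto
  with assms have "bal_GC t \<le> \<beta>"
    by (auto simp: GCB_def balanced_node_def)
  then have max: "Max {weight_at t [a, b] | a b. True} \<le> \<beta> * real (size1 t)"
    by (simp add: bal_GC_def divide_le_eq)
  \<comment> \<open>The pairs of directions form a finite type; finiteness is what makes
    \<open>Max\<close> an upper bound.\<close>
  have "{weight_at t [a, b] | a b. True} = (\<lambda>(a, b). weight_at t [a, b]) ` UNIV"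
    by auto
  then have "finite {weight_at t [a, b] | a b. True}"
    by simp
  then have "weight_at t [a, b] \<le> Max {weight_at t [a, b] | a b. True}"
    by (rule Max_ge) blast
  with max show ?thesis
    by linarith
qed

text \<open>The weight equation covers every continuation \<open>p\<close>, so that two descents
  compose into the weight of a grandchild.\<close>

lemma tallest_child:
  assumes "t \<noteq> Leaf"
  obtains b u where "u \<in> subtrees t" "height t = Suc (height u)"
    "\<And>p. weight_at t (b # p) = weight_at u p"
proof (cases t)
  case (Node l x r)
  have self: "l \<in> subtrees l" "r \<in> subtrees r"
    by (cases l; simp) (cases r; simp)
  show ?thesis
  proof (cases "height l \<le> height r")
    case True
    with Node self show ?thesis
      by (intro that[of r True]) auto
  next
    case False
    with Node self show ?thesis
      by (intro that[of l False]) auto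
  qed
qed (use assms in simp)

text \<open>Height at least 2 ensures that both descents stay inside the tree, so that
  \<open>u\<close> is an actual sub-tree, possibly \<open>Leaf\<close>, and not a virtual node below
  an empty tree.\<close>

lemma tallest_grandchild:
  fixes t :: "'a tree"
  assumes "GCB \<alpha> \<beta> t" "2 \<le> height t"
  obtains u :: "'a tree" where "GCB \<alpha> \<beta> u" "height t = height u + 2" "real (size1 u) \<le> \<beta> * real (size1 t)"
proof -
  have t: "t \<noteq> Leaf"
    using assms(2) by auto
  obtain a v where v: "v \<in> subtrees t" "height t = Suc (height v)"
    "\<And>p. weight_at t (a # p) = weight_at v p"
    using tallest_child[OF t] by blast
  have "v \<noteq> Leaf"
    using v(2) assms(2) by auto
  then obtain b u where u: "u \<in> subtrees v" "height v = Suc (height u)"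
    "\<And>p. weight_at v (b # p) = weight_at u p"
    using tallest_child[of v] by blast
  have "weight_at t [a, b] = real (size1 u)"
    by (simp add: v(3) u(3))
  with weight_grandchild_le[OF assms(1) t, of a b]
  have "real (size1 u) \<le> \<beta> * real (size1 t)"
    by simp
  moreover have "GCB \<alpha> \<beta> u"
    using assms(1) u(1) v(1) by (blast intro: GCB_subtree)
  ultimately show ?thesis
    using v(2) u(2) by (intro that[of u]) auto
qed

lemma GCB_weight_height:
  fixes t :: "'a tree"
  assumes "1 / 4 \<le> \<beta>" "GCB \<alpha> \<beta> t"
  shows "1 \<le> (real (size1 t))\<^sup>2 * \<beta> ^ (height t - 1)"
  using assms(2)
proof (induction "height t" arbitrary: t rule: less_induct)
  case less
  \<comment> \<open>Height 2 is a base case: its tallest grandchild is \<open>Leaf\<close>, where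
    truncated subtraction makes the exponent drop by 1 instead of 2.\<close>
  consider "height t \<le> 1" | "height t = 2" | "3 \<le> height t"
    by linarith
  then show ?case
  proof cases
    case 1
    then show ?thesis
      by (simp add: size1_size)
  next
    case 2
    then have "2 \<le> real (size1 t)"
      using height_le_size_tree[of t] by (simp add: size1_size)
    then have "2\<^sup>2 \<le> (real (size1 t))\<^sup>2"
      by (intro power_mono) auto
    \<comment> \<open>The exponent is 1 here, and the left-hand side equals 1: weight 2 exactly
      offsets the bound 1/4 on \<beta>.\<close>
    with assms(1) have "2\<^sup>2 * (1 / 4) \<le> (real (size1 t))\<^sup>2 * \<beta>"
      by (intro mult_mono) auto
    with 2 show ?thesis
      by simp
  next
    case 3
    then obtain u :: "'a tree" where u: "GCB \<alpha> \<beta> u" "height t = height u + 2"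
      "real (size1 u) \<le> \<beta> * real (size1 t)"
      using tallest_grandchild[OF less.prems] by auto
    \<comment> \<open>Here \<open>u\<close> is nonempty, so nothing is truncated; the two extra
      levels absorb the factor \<open>\<beta>\<^sup>2\<close> that comes from squaring the weight
      bound.\<close>
    have exponent: "height t - 1 = (height u - 1) + 2"
      using 3 u(2) by simp
    have "1 \<le> (real (size1 u))\<^sup>2 * \<beta> ^ (height u - 1)"
      using less.hyps[of u] u by simp
    also have "\<dots> \<le> (\<beta> * real (size1 t))\<^sup>2 * \<beta> ^ (height u - 1)"
      using u(3) assms(1) by (intro mult_right_mono power_mono) auto
    also have "\<dots> = (real (size1 t))\<^sup>2 * \<beta> ^ (height t - 1)"
      unfolding exponent power_add by (simp add: power_mult_distrib)
    finally show ?thesis .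
  qed
qed

text \<open>The lower bound comes from \<alpha> / 2 with \<alpha> \<ge> 1/2. For the upper one,
  \<open>\<beta> \<le> \<alpha>\<^sup>2 \<le> \<alpha>\<close> settles \<alpha> < 1, and removing
  the corner (1, 1) settles \<alpha> = 1.\<close>

lemma GCB_domain_bounds:
  assumes "(\<alpha>, \<beta>) \<in> GCB_domain"
  shows "1 / 4 \<le> \<beta>" "\<beta> < 1"
proof -
  have *: "\<alpha> / 2 \<le> \<beta>" "\<beta> \<le> \<alpha>\<^sup>2" "1 / 2 \<le> \<alpha>" "\<alpha> \<le> 1" "(\<alpha>, \<beta>) \<noteq> (1, 1)"
    using assms by (auto simp: GCB_domain_def)
  show "1 / 4 \<le> \<beta>"
    using * by linarith
  have "\<alpha>\<^sup>2 \<le> \<alpha>"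
    using * by (simp add: power2_eq_square mult_left_le)
  with * show "\<beta> < 1"
    by (cases "\<alpha> = 1") auto
qed

theorem theorem1:
  fixes \<alpha> \<beta> :: real and t :: "'a tree" and N :: nat
  assumes "(\<alpha>, \<beta>) \<in> GCB_domain"
    and "GCB \<alpha> \<beta> t"
    and "size t = N"
  shows "real (max_depth t) \<le> - 2 * log \<beta> (real N + 1)"
proof -
  note \<beta> = GCB_domain_bounds[OF assms(1)]
  have "1 \<le> (real N + 1)\<^sup>2 * \<beta> ^ max_depth t"
    using GCB_weight_height[OF \<beta>(1) assms(2)] assms(3)
    by (simp add: max_depth_eq_height size1_size add.commute)
  then have "0 \<le> ln ((real N + 1)\<^sup>2 * \<beta> ^ max_depth t)"
    by (rule ln_ge_zero)
  also have "\<dots> = 2 * ln (real N + 1) + real (max_depth t) * ln \<beta>"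
    using \<beta> by (simp add: ln_mult ln_realpow)
  finally have "0 \<le> 2 * ln (real N + 1) + real (max_depth t) * ln \<beta>" .
  \<comment> \<open>Dividing by this negative number reverses the inequality and turns
    \<open>ln\<close> into \<open>log \<beta>\<close>.\<close>
  moreover have "ln \<beta> < 0"
    using \<beta> by simp
  ultimately show ?thesis
    by (simp add: log_def field_simps)
qed

end
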